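(* Let $s\in[0,1)$ and let $s = 0.a_1a_2\ldots$ be its upper binary expansion. Then for all $\tilde{u}_0\in\tilde{K}$, $$\lim_{t \to s,\ t > s}\ \pi\big(u(t) - u(s)\big) = \lim_{n \to \infty} \tilde{M}_{a_1 \ldots a_n} (\tilde{u}_0),$$ that is, both limits always exist and are always equal. Likewise, let $s\in(0,1]$ and let $s=0.a_1a_2\ldots$ be its lower binary expansion. Then for all $\tilde{u}_0\in\tilde{K}$, both of the following limits exist and $$\lim_{t \to s,\ t < s}\ \pi\big(u(s) - u(t)\big) = \lim_{n \to \infty} \tilde{M}_{a_1 \ldots a_n} (\tilde{u}_0).$$
   Context: Let $M_0 = \frac{1}{5}\begin{pmatrix} 5 & 2 & 2\\ 0 & 2 & 1\\ 0 & 1 & 2 \end{pmatrix}$ and $M_1 = \frac{1}{5}\begin{pmatrix} 2 & 0 & 1\\ 2 & 5 & 2\\ 1 & 0 & 2 \end{pmatrix}$, and let $h_0(x) = \frac{x}{2}$, $h_1(x) = \frac{x+1}{2}$. Let $u:[0,1]\to\mathbb{R}^3$ be the unique continuous function satisfying $u(0) = (1,0,0)^T$, $u(1) = (0,1,0)^T$, $u\circ h_0 = M_0\circ u$ and $u \circ h_1 = M_1\circ u$ on $[0,1]$ (this function is known to exist, to be unique, and to be injective; all its values lie in the affine plane $x+y+z=1$). Let $\vec{\mathcal{H}} = \{(x,y,z)\in\mathbb{R}^3 : x+y+z=0\}$, a vector plane stable by the invertible matrices $M_0$ and $M_1$. Let $\vec{v}_0 = (-1,\frac12,\frac12)^T$,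 $\vec{v}_1 = (-\frac12,1,-\frac12)^T$ and $$\vec{K} := \{a\vec{v}_0+b\vec{v}_1 : a,b\ge 0,\ (a,b)\ne(0,0)\}\subset\vec{\mathcal{H}}.$$ Let $\pi:\vec{\mathcal{H}}\setminus\{0\}\to\mathbb{P}^1(\mathbb{R})$ be the canonical projection onto the projective line of $\vec{\mathcal{H}}$, let $\tilde{K} := \pi(\vec{K})$, and for $i\in\{0,1\}$ let $\tilde{M}_i:\mathbb{P}^1(\mathbb{R})\to\mathbb{P}^1(\mathbb{R})$ be given by $\tilde{M}_i(\pi(\vec{x})) = \pi(M_i\vec{x})$. For a finite word, $\tilde{M}_{a_1\ldots a_n} := \tilde{M}_{a_1}\circ\cdots\circ\tilde{M}_{a_n}$. Here $t$ ranges over $[0,1]$. For $s\in[0,1)$ (resp. $s\in(0,1]$), the upper (resp. lower) binary expansion of $s$ is the unique sequence $(a_i)_{i\ge1}$ in $\{0,1\}$ with $s = \sum_{i\ge1} a_i2^{-i}$ that does not end with an infinite sequence of $1$'s (resp. of $0$'s). *)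

theory Defs
  imports "HOL-Analysis.Analysis"
begin

definition M0 :: "real^3^3" where
  "M0 = (1/5) *\<^sub>R vector [vector [5, 2, 2], vector [0, 2, 1], vector [0, 1, 2]]"

definition M1 :: "real^3^3" where
  "M1 = (1/5) *\<^sub>R vector [vector [2, 0, 1], vector [2, 5, 2], vector [1, 0, 2]]"

definition M :: "nat \<Rightarrow> real^3^3" where
  "M i = (if i = 0 then M0 else M1)"

definition h0 :: "real \<Rightarrow> real" where "h0 x = x / 2"

definition h1 :: "real \<Rightarrow> real" where "h1 x = (x + 1) / 2"

text \<open>
  A function on \<open>[0,1]\<close> is modelled by a total function on the reals whose values outside
  \<open>[0,1]\<close> are irrelevant; the conditions below determine it on \<open>[0,1]\<close>.
\<close>

definition is_curve :: "(real \<Rightarrow> real^3) \<Rightarrow> bool" where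
  "is_curve u \<longleftrightarrow>
     continuous_on {0..1} u \<and>
     u 0 = vector [1, 0, 0] \<and> u 1 = vector [0, 1, 0] \<and>
     (\<forall>x\<in>{0..1}. u (h0 x) = M0 *v u x) \<and>
     (\<forall>x\<in>{0..1}. u (h1 x) = M1 *v u x)"

definition H :: "(real^3) set" where
  "H = {x. x$1 + x$2 + x$3 = 0}"

definition v0 :: "real^3" where "v0 = vector [-1, 1/2, 1/2]"

definition v1 :: "real^3" where "v1 = vector [-1/2, 1, -1/2]"

definition K :: "(real^3) set" where
  "K = {a *\<^sub>R v0 + b *\<^sub>R v1 | a b. a \<ge> 0 \<and> b \<ge> 0 \<and> (a, b) \<noteq> (0, 0)}"

text \<open>
  The projective line of \<open>H\<close> is the set of lines through the origin in \<open>H\<close>, with the quotient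
  topology induced by \<open>proj\<close>. The function \<open>proj\<close> is total, but \<open>proj x\<close> is a point of the
  projective line only if \<open>x\<close> is a nonzero vector of \<open>H\<close>.
\<close>

definition proj :: "real^3 \<Rightarrow> (real^3) set" where
  "proj x = span {x}"

definition PH :: "(real^3) set topology" where
  "PH = topology (\<lambda>U. U \<subseteq> proj ` (H - {0}) \<and>
                      openin (top_of_set (H - {0})) {x \<in> H - {0}. proj x \<in> U})"

definition K_proj :: "(real^3) set set" where
  "K_proj = proj ` K"

text \<open>A linear map acts on lines by taking images; see \<open>M_proj_proj\<close> below.\<close>

definition M_proj :: "nat \<Rightarrow> (real^3) set \<Rightarrow> (real^3) set" where
  "M_proj i L = (\<lambda>x. M i *v x) ` L"

primrec M_word :: "nat list \<Rightarrow> (real^3) set \<Rightarrow> (real^3) set" where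
  "M_word [] = id"
| "M_word (a # w) = M_proj a \<circ> M_word w"

text \<open>Digit sequences are indexed from 1; the value \<open>a 0\<close> is ignored.\<close>

definition binary_expansion :: "real \<Rightarrow> (nat \<Rightarrow> nat) \<Rightarrow> bool" where
  "binary_expansion s a \<longleftrightarrow>
     (\<forall>i\<ge>1. a i \<in> {0, 1}) \<and> (\<lambda>i. real (a (Suc i)) / 2 ^ Suc i) sums s"

definition upper_binary_expansion :: "real \<Rightarrow> (nat \<Rightarrow> nat) \<Rightarrow> bool" where
  "upper_binary_expansion s a \<longleftrightarrow> binary_expansion s a \<and> \<not> (\<exists>N. \<forall>i\<ge>N. a i = 1)"

definition lower_binary_expansion :: "real \<Rightarrow> (nat \<Rightarrow> nat) \<Rightarrow> bool" where
  "lower_binary_expansion s a \<longleftrightarrow> binary_expansion s a \<and> \<not> (\<exists>N. \<forall>i\<ge>N. a i = 0)"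

definition digits :: "(nat \<Rightarrow> nat) \<Rightarrow> nat \<Rightarrow> nat list" where
  "digits a n = map a [1..<Suc n]"


lemma M_proj_proj: "M_proj i (proj x) = proj (M i *v x)"
  using linear_span_image[OF matrix_vector_mul_linear, of "M i" "{x}"]
  by (simp add: M_proj_def proj_def)

lemma openin_PH:
  "openin PH U \<longleftrightarrow> U \<subseteq> proj ` (H - {0}) \<and>
     openin (top_of_set (H - {0})) {x \<in> H - {0}. proj x \<in> U}"
proof -
  let ?X = "top_of_set (H - {0})"
  let ?P = "\<lambda>U. U \<subseteq> proj ` (H - {0}) \<and> openin ?X {x \<in> H - {0}. proj x \<in> U}"
  have "istopology ?P"
    unfolding istopology_def
  proof (intro conjI allI impI)
    fix S T assume S: "?P S" and T: "?P T"
    have "{x \<in> H - {0}. proj x \<in> S \<inter> T} =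
          {x \<in> H - {0}. proj x \<in> S} \<inter> {x \<in> H - {0}. proj x \<in> T}" by auto
    then show "openin ?X {x \<in> H - {0}. proj x \<in> S \<inter> T}"
      using S T by (metis (no_types, lifting) openin_Int)
    show "S \<inter> T \<subseteq> proj ` (H - {0})" using S by blast
  next
    fix \<K> assume K: "\<forall>S\<in>\<K>. ?P S"
    have "{x \<in> H - {0}. proj x \<in> \<Union>\<K>} = (\<Union>S\<in>\<K>. {x \<in> H - {0}. proj x \<in> S})" by auto
    then show "openin ?X {x \<in> H - {0}. proj x \<in> \<Union>\<K>}"
      using K by auto
    show "\<Union>\<K> \<subseteq> proj ` (H - {0})" using K by blast
  qed
  then show ?thesis by (simp add: PH_def)
qed

lemma topspace_PH: "topspace PH = proj ` (H - {0})"
proof -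
  have "{x \<in> H - {0}. proj x \<in> proj ` (H - {0})} = H - {0}" by auto
  then have "openin PH (proj ` (H - {0}))"
    by (simp add: openin_PH)
  then have "proj ` (H - {0}) \<subseteq> topspace PH"
    by (rule openin_subset)
  moreover have "topspace PH \<subseteq> proj ` (H - {0})"
    using iffD1[OF openin_PH openin_topspace] by (rule conjunct1)
  ultimately show ?thesis by (rule subset_antisym[rotated])
qed

lemma quotient_map_proj: "quotient_map (top_of_set (H - {0})) PH proj"
  by (auto simp: quotient_map_def topspace_PH openin_PH)

lemma Hausdorff_space_PH: "Hausdorff_space PH"
proof -
  define f :: "real^3 \<Rightarrow> real^3^3" where "f x = (\<chi> i j. x$i * x$j / (x \<bullet> x))" for x
  have cont: "continuous_map (top_of_set (H - {0})) euclidean f"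
    unfolding f_def by (auto intro!: continuous_intros)
  have const: "f x = f y" if "proj x = proj y" "x \<noteq> 0" "y \<noteq> 0" for x y
  proof -
    have "y \<in> span {x}" using that by (metis proj_def singletonI span_base)
    then obtain c where "y = c *\<^sub>R x" by (auto simp: span_singleton)
    moreover have "f (c *\<^sub>R x) = f x" if "c \<noteq> 0"
      using that by (simp add: f_def vec_eq_iff)
    ultimately show ?thesis using that by auto
  qed
  have inj: "proj x = proj y" if eq: "f x = f y" and nz: "x \<noteq> 0" "y \<noteq> 0" for x y
  proof -
    have app: "f x *v z = ((x \<bullet> z) / (x \<bullet> x)) *\<^sub>R x" for x z
      by (simp add: f_def vec_eq_iff matrix_vector_mult_def inner_vec_def sum_3 algebra_simps
          add_divide_distrib)
    have "y = ((x \<bullet> y) / (x \<bullet> x)) *\<^sub>R x"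
      using app[of y y] app[of x y] nz by (simp add: eq)
    moreover have "x = ((y \<bullet> x) / (y \<bullet> y)) *\<^sub>R y"
      using app[of x x] app[of y x] nz by (simp add: eq)
    ultimately have "y \<in> span {x}" "x \<in> span {y}"
      by (metis rangeI span_singleton)+
    then show ?thesis
      unfolding proj_def by (intro subset_antisym span_minimal) auto
  qed
  have const': "f x = f y"
    if "x \<in> topspace (top_of_set (H - {0}))" "y \<in> topspace (top_of_set (H - {0}))"
       "proj x = proj y" for x y
    by (rule const) (use that in simp_all)
  obtain g where g: "continuous_map PH euclidean g"
    and "g ` topspace PH = f ` topspace (top_of_set (H - {0}))"
    and gf': "\<And>x. x \<in> topspace (top_of_set (H - {0})) \<Longrightarrow> g (proj x) = f x"
    by (rule quotient_map_lift_exists[OF quotient_map_proj cont]) (erule (2) const', rule that)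
  have gf: "g (proj x) = f x" if "x \<in> H - {0}" for x
    by (rule gf') (use that in simp)
  have "inj_on g (topspace PH)"
    unfolding topspace_PH
  proof (rule inj_onI)
    fix a b assume a: "a \<in> proj ` (H - {0})" and b: "b \<in> proj ` (H - {0})" and ab: "g a = g b"
    from a obtain x where x: "x \<in> H - {0}" "a = proj x" by (rule imageE)
    from b obtain y where y: "y \<in> H - {0}" "b = proj y" by (rule imageE)
    have "f x = f y" using ab x(2) y(2) gf[OF x(1)] gf[OF y(1)] by simp
    then have "proj x = proj y" by (rule inj) (use x(1) y(1) in simp_all)
    then show "a = b" using x y by simp
  qed
  then show ?thesis
    by (rule Hausdorff_space_injective_preimage[OF Hausdorff_space_euclidean g])
qed

end

theory Submission
  imports Defs
begin

text \<open>
  In the basis \<open>v0, v1\<close> of \<open>H\<close> the two matrices are nonnegative: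
  \<open>M0 v0 = 3/5 v0\<close>, \<open>M0 v1 = 1/5 (v0 + v1)\<close>, and \<open>M1\<close> is the same with \<open>v0\<close> and \<open>v1\<close> exchanged.
  So both map the cone \<open>K\<close> into itself. Describe a ray of \<open>K\<close> by the number
  \<open>p\<close> in \<open>[0,1]\<close> for which it contains \<open>p v0 + (1 - p) v1\<close>. On this parameter \<open>M0\<close> and \<open>M1\<close>
  act by two Moebius maps, and both contract \<open>[0,1]\<close> by the factor \<open>3/4\<close>
  (\<open>slope_contraction\<close>). Hence along any digit sequence the nested cones
  \<open>M_vec (digits a n) ` K\<close> shrink to a single line \<open>l\<close> (\<open>nested_cones_shrink\<close>), so the words applied
  to any line of \<open>K\<close> converge to \<open>l\<close>.

  The chords of the curve meet the same cones. The total increment \<open>u 1 - u 0\<close> lies in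
  \<open>K\<close>; by self-similarity so does every increment over a dyadic interval, and by adding increments
  and passing to the limit the curve is strictly increasing for the order given by \<open>K\<close>
  (\<open>curve_strict_mono\<close>). Now let \<open>t\<close> lie in the same dyadic interval of level \<open>n\<close> as \<open>s\<close>, the one
  with address \<open>a 1, \<dots>, a n\<close>. Pulling both points back to \<open>[0,1]\<close> writes the chord from
  \<open>s\<close> to \<open>t\<close> as the image under this word of a chord that belongs to \<open>K\<close>, hence it lies in the
  \<open>n\<close>-th cone. The upper expansion is the one
  for which \<open>s\<close> is never the right end point of its interval, so that all \<open>t > s\<close> close enough to
  \<open>s\<close> qualify (\<open>right_chords_in_cone\<close>); the lower expansion plays this part for \<open>t < s\<close>
  (\<open>left_chords_in_cone\<close>). The directions of the chords are thus caught in the same shrinking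
  cones and converge to \<open>l\<close> too.
\<close>

section \<open>The action of the matrices on the cone\<close>

definition dir :: "real \<Rightarrow> real^3" where
  "dir p = p *\<^sub>R v0 + (1 - p) *\<^sub>R v1"

text \<open>
  The action of \<open>M a\<close> on the parameter \<open>p\<close> of the ray through \<open>dir p\<close>; compare \<open>M_dir\<close>.
\<close>

definition slope :: "nat \<Rightarrow> real \<Rightarrow> real" where
  "slope a p = (if a = 0 then (1 + 2 * p) / (2 + p) else p / (3 - p))"

abbreviation M_vec :: "nat list \<Rightarrow> real^3 \<Rightarrow> real^3" where
  "M_vec \<equiv> foldr (\<lambda>a x. M a *v x)"

abbreviation slope_word :: "nat list \<Rightarrow> real \<Rightarrow> real" where
  "slope_word \<equiv> foldr slope"

lemma K_iff_dir: "x \<in> K \<longleftrightarrow> (\<exists>c>0. \<exists>p\<in>{0..1}. x = c *\<^sub>R dir p)"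
proof
  assume "x \<in> K"
  then obtain a b where ab: "x = a *\<^sub>R v0 + b *\<^sub>R v1" "a \<ge> 0" "b \<ge> 0" "(a, b) \<noteq> (0, 0)"
    by (auto simp: K_def)
  then have pos: "a + b > 0" by auto
  then have "1 - a / (a + b) = b / (a + b)" by (simp add: field_simps)
  then have "x = (a + b) *\<^sub>R dir (a / (a + b))"
    using ab(1) pos by (simp add: dir_def scaleR_add_right)
  moreover have "a / (a + b) \<in> {0..1}" using ab pos by simp
  ultimately show "\<exists>c>0. \<exists>p\<in>{0..1}. x = c *\<^sub>R dir p" using pos by blast
next
  assume "\<exists>c>0. \<exists>p\<in>{0..1}. x = c *\<^sub>R dir p"
  then obtain c p where cp: "c > 0" "p \<in> {0..1}" "x = c *\<^sub>R dir p" by auto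
  then have "x = (c * p) *\<^sub>R v0 + (c * (1 - p)) *\<^sub>R v1"
    by (simp add: dir_def scaleR_add_right)
  moreover have "(c * p, c * (1 - p)) \<noteq> (0, 0)" using cp by auto
  ultimately show "x \<in> K" unfolding K_def using cp by fastforce
qed

lemma M_dir:
  "M a *v dir p = ((if a = 0 then 2 + p else 3 - p) / 5) *\<^sub>R dir (slope a p)" if "p \<in> {0..1}"
proof -
  have "2 + p \<noteq> 0" "3 - p \<noteq> 0" using that by auto
  then show ?thesis
    by (auto simp: M_def M0_def M1_def dir_def slope_def v0_def v1_def vec_eq_iff forall_3
        matrix_vector_mult_def sum_3 field_simps)
qed

lemma slope_in_unit: "slope a p \<in> {0..1}" if "p \<in> {0..1}"
  using that by (auto simp: slope_def field_simps)

text \<open>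
  The difference quotients are \<open>3 / ((2 + p) (2 + q))\<close> and \<open>3 / ((3 - p) (3 - q))\<close>, whose
  denominators are at least \<open>4\<close> on the unit interval. Equality is approached for
  \<open>p\<close> and \<open>q\<close> near \<open>0\<close> (resp. near \<open>1\<close>), so \<open>3/4\<close> is the best constant.
\<close>

lemma slope_contraction:
  assumes "p \<in> {0..1}" "q \<in> {0..1}"
  shows "\<bar>slope a p - slope a q\<bar> \<le> 3/4 * \<bar>p - q\<bar>"
proof -
  define D where "D = (if a = 0 then (2 + p) * (2 + q) else (3 - p) * (3 - q))"
  have D: "D \<ge> 4"
    using assms mult_mono[of 2 "2 + p" 2 "2 + q"] mult_mono[of 2 "3 - p" 2 "3 - q"]
    by (auto simp: D_def)
  have nz: "2 + p \<noteq> 0" "2 + q \<noteq> 0" "3 - p \<noteq> 0" "3 - q \<noteq> 0" using assms by auto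
  have "slope a p - slope a q = 3 * (p - q) / D"
    unfolding slope_def D_def using nz by (cases "a = 0") (simp_all add: diff_frac_eq algebra_simps)
  then have "\<bar>slope a p - slope a q\<bar> = 3 * \<bar>p - q\<bar> / D"
    using D by (simp only: abs_mult abs_divide)
  also have "\<dots> \<le> 3 * \<bar>p - q\<bar> / 4"
    by (rule divide_left_mono) (use D in auto)
  finally show ?thesis by simp
qed

lemma slope_word_in_unit: "p \<in> {0..1} \<Longrightarrow> slope_word w p \<in> {0..1}"
  by (induction w) (auto simp del: atLeastAtMost_iff intro: slope_in_unit)

lemma slope_word_contraction:
  assumes "p \<in> {0..1}" "q \<in> {0..1}"
  shows "\<bar>slope_word w p - slope_word w q\<bar> \<le> (3/4) ^ length w"
proof (induction w)
  case Nil
  then show ?case using assms by auto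
next
  case (Cons a w)
  have "\<bar>slope_word (a # w) p - slope_word (a # w) q\<bar>
      \<le> 3/4 * \<bar>slope_word w p - slope_word w q\<bar>"
    using slope_contraction slope_word_in_unit assms by simp
  then show ?case using Cons by simp
qed

lemma M_vec_dir:
  assumes "p \<in> {0..1}"
  shows "\<exists>c>0. M_vec w (dir p) = c *\<^sub>R dir (slope_word w p)"
proof (induction w)
  case Nil
  show ?case by (auto intro: exI[of _ 1])
next
  case (Cons a w)
  then obtain c where c: "c > 0" "M_vec w (dir p) = c *\<^sub>R dir (slope_word w p)" by auto
  let ?k = "(if a = 0 then 2 + slope_word w p else 3 - slope_word w p) / 5"
  have "c * ?k > 0" using c(1) slope_word_in_unit[OF assms, of w] by auto
  moreover have "M_vec (a # w) (dir p) = (c * ?k) *\<^sub>R dir (slope_word (a # w) p)"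
    using c(2) M_dir[OF slope_word_in_unit[OF assms]] by (simp add: matrix_vector_mult_scaleR)
  ultimately show ?case by blast
qed

lemma M_vec_scaleR: "M_vec w (c *\<^sub>R x) = c *\<^sub>R M_vec w x"
  by (induction w) (auto simp: matrix_vector_mult_scaleR)

lemma M_vec_diff: "M_vec w (x - y) = M_vec w x - M_vec w y"
  by (induction w) (auto simp: matrix_vector_mult_diff_distrib)

lemma proj_scaleR: "c \<noteq> 0 \<Longrightarrow> proj (c *\<^sub>R x) = proj x"
  unfolding proj_def using span_image_scale[of "{x}" "\<lambda>_. c"] by simp

lemma M_word_proj: "M_word w (proj x) = proj (M_vec w x)"
  by (induction w) (auto simp: M_proj_proj)

lemma M_vec_K_subset: "M_vec w ` K \<subseteq> K"
proof -
  have "M_vec w (c *\<^sub>R dir p) \<in> K" if c: "c > 0" and p: "p \<in> {0..1}" for c p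
  proof -
    obtain c' where "c' > 0" "M_vec w (dir p) = c' *\<^sub>R dir (slope_word w p)"
      using M_vec_dir[OF p] by blast
    then have "M_vec w (c *\<^sub>R dir p) = (c * c') *\<^sub>R dir (slope_word w p)" "c * c' > 0"
      using c by (simp_all add: M_vec_scaleR)
    then show ?thesis using slope_word_in_unit[OF p] unfolding K_iff_dir by blast
  qed
  then show ?thesis by (auto simp: K_iff_dir simp del: atLeastAtMost_iff)
qed

lemma proj_M_vec_K:
  assumes "x \<in> M_vec w ` K"
  shows "\<exists>p\<in>{0..1}. proj x = proj (dir (slope_word w p))"
proof -
  obtain c p where c: "c > 0" and p: "p \<in> {0..1}" and x: "x = M_vec w (c *\<^sub>R dir p)"
    using assms by (auto simp: K_iff_dir)
  obtain c' where "c' > 0" "M_vec w (dir p) = c' *\<^sub>R dir (slope_word w p)"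
    using M_vec_dir[OF p] by blast
  then have "x = (c * c') *\<^sub>R dir (slope_word w p)" "c * c' \<noteq> 0"
    using c x by (simp_all add: M_vec_scaleR)
  then show ?thesis using p proj_scaleR by blast
qed

section \<open>Convergence of the nested cones\<close>

lemma dir_in_H: "dir p \<in> H - {0}"
proof -
  have "dir p $ 3 = p - 1/2" "dir p $ 2 = 1 - p/2"
    by (simp_all add: dir_def v0_def v1_def field_simps)
  then have "dir p \<noteq> 0" by (intro notI) simp
  then show ?thesis by (simp add: dir_def H_def v0_def v1_def algebra_simps)
qed

lemma continuous_map_proj_dir: "continuous_map euclidean PH (\<lambda>p. proj (dir p))"
proof -
  have "continuous_map euclidean (top_of_set (H - {0})) dir"
    unfolding continuous_map_in_subtopology using dir_in_H
    by (auto simp: dir_def intro!: continuous_intros)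
  moreover have "continuous_map (top_of_set (H - {0})) PH proj"
    by (rule quotient_imp_continuous_map[OF quotient_map_proj])
  ultimately show ?thesis
    using continuous_map_compose by (fastforce simp: o_def)
qed

lemma digits_prefix: "\<exists>w. digits a (n + k) = digits a n @ w"
  using upt_add_eq_append[of 1 "Suc n" k] by (auto simp: digits_def)

lemma length_digits [simp]: "length (digits a n) = n"
  by (simp add: digits_def)

text \<open>
  Longer prefixes only append letters on the inner side of the composition, so all later values lie
  in the image of \<open>[0,1]\<close> under the first \<open>n\<close> letters, an interval of length at most \<open>(3/4)^n\<close>. The
  limit is therefore common to all starting points, with a uniform rate.
\<close>

lemma slope_word_digits_limit:
  "\<exists>P. \<forall>n. \<forall>p\<in>{0..1}. \<bar>slope_word (digits a n) p - P\<bar> \<le> (3/4) ^ n"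
proof -
  define f where "f n = slope_word (digits a n) 0" for n
  have close: "\<bar>slope_word (digits a n) p - f (n + k)\<bar> \<le> (3/4) ^ n" if "p \<in> {0..1}" for n k p
  proof -
    obtain w where "digits a (n + k) = digits a n @ w" using digits_prefix by blast
    then have "f (n + k) = slope_word (digits a n) (slope_word w 0)" by (simp add: f_def)
    moreover have "slope_word w 0 \<in> {0..1}" by (rule slope_word_in_unit) simp
    ultimately show ?thesis using slope_word_contraction[OF that, of _ "digits a n"] by simp
  qed
  have "Cauchy f"
  proof (rule CauchyI')
    fix e :: real assume "e > 0"
    then obtain n where n: "(3/4 :: real) ^ n < e" using real_arch_pow_inv[of e "3/4"] by auto
    have "dist (f m) (f k) < e" if "m \<ge> n" "k > m" for m k
    proof -
      have "\<bar>f m - f (m + (k - m))\<bar> \<le> (3/4) ^ m"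
        using close[of 0 m "k - m"] by (simp add: f_def)
      also have "\<dots> \<le> (3/4) ^ n" using that by (intro power_decreasing) auto
      finally show ?thesis using n that by (simp add: dist_real_def)
    qed
    then show "\<exists>M. \<forall>m\<ge>M. \<forall>n>m. dist (f m) (f n) < e" by blast
  qed
  then obtain P where P: "f \<longlonglongrightarrow> P"
    using Cauchy_convergent convergent_def by blast
  have "\<bar>slope_word (digits a n) p - P\<bar> \<le> (3/4) ^ n" if "p \<in> {0..1}" for n p
  proof (rule tendsto_upperbound)
    show "(\<lambda>k. \<bar>slope_word (digits a n) p - f (k + n)\<bar>) \<longlonglongrightarrow> \<bar>slope_word (digits a n) p - P\<bar>"
      by (intro tendsto_intros LIMSEQ_ignore_initial_segment P)
    show "\<forall>\<^sub>F k in sequentially. \<bar>slope_word (digits a n) p - f (k + n)\<bar> \<le> (3/4) ^ n"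
      using close[OF that, of n] by (simp add: add.commute)
  qed simp
  then show ?thesis by blast
qed

text \<open>
  This form of convergence, about sets rather than about a particular sequence, serves both limits of
  the theorem at once. Uniformity in \<open>p\<close> turns a neighbourhood of the limit line into a level \<open>n\<close>
  at which the whole cone is inside it.
\<close>

lemma nested_cones_shrink:
  "\<exists>l\<in>topspace PH. \<forall>U. openin PH U \<and> l \<in> U \<longrightarrow> (\<exists>n. proj ` M_vec (digits a n) ` K \<subseteq> U)"
proof -
  obtain P where P: "\<And>n p. p \<in> {0..1} \<Longrightarrow> \<bar>slope_word (digits a n) p - P\<bar> \<le> (3/4) ^ n"
    using slope_word_digits_limit by blast
  have "\<exists>n. proj ` M_vec (digits a n) ` K \<subseteq> U" if U: "openin PH U" "proj (dir P) \<in> U" for U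
  proof -
    have "open {p. proj (dir p) \<in> U}"
      using openin_continuous_map_preimage[OF continuous_map_proj_dir U(1)] by simp
    then obtain e where e: "e > 0" "\<And>p. \<bar>p - P\<bar> < e \<Longrightarrow> proj (dir p) \<in> U"
      using U(2) by (auto simp: open_dist dist_real_def)
    obtain n where "(3/4 :: real) ^ n < e" using real_arch_pow_inv[of e "3/4"] e(1) by auto
    then have "proj (dir (slope_word (digits a n) p)) \<in> U" if "p \<in> {0..1}" for p
      using P[OF that, of n] e(2) by force
    then have "proj x \<in> U" if "x \<in> M_vec (digits a n) ` K" for x
      using proj_M_vec_K[OF that] by auto
    then have "proj ` M_vec (digits a n) ` K \<subseteq> U" by (rule image_subsetI)
    then show ?thesis by blast
  qed
  moreover have "proj (dir P) \<in> topspace PH" using dir_in_H by (auto simp: topspace_PH)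
  ultimately show ?thesis by blast
qed

lemma M_vec_digits_nested:
  assumes "n \<le> m"
  shows "M_vec (digits a m) ` K \<subseteq> M_vec (digits a n) ` K"
proof -
  obtain w where "digits a m = digits a n @ w"
    using digits_prefix[of a n "m - n"] assms by auto
  then show ?thesis using M_vec_K_subset[of w] by auto
qed

section \<open>Monotonicity of the curve with respect to the cone\<close>

lemma K_add:
  assumes "x \<in> K" "y \<in> K"
  shows "x + y \<in> K"
proof -
  obtain a b where x: "x = a *\<^sub>R v0 + b *\<^sub>R v1" "a \<ge> 0" "b \<ge> 0" "(a, b) \<noteq> (0, 0)"
    using \<open>x \<in> K\<close> unfolding K_def by blast
  obtain c d where y: "y = c *\<^sub>R v0 + d *\<^sub>R v1" "c \<ge> 0" "d \<ge> 0"
    using \<open>y \<in> K\<close> unfolding K_def by blast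
  have "x + y = (a + c) *\<^sub>R v0 + (b + d) *\<^sub>R v1"
    using x y by (simp add: algebra_simps)
  moreover have "a + c \<ge> 0" "b + d \<ge> 0" "(a + c, b + d) \<noteq> (0, 0)" using x y by auto
  ultimately show ?thesis unfolding K_def by blast
qed

text \<open>
  Adding \<open>0\<close> turns \<open>K\<close> into an intersection of a plane and two closed half-spaces. Without \<open>0\<close>
  it is not closed, so limits of chords are at first only known to be in \<open>insert 0 K\<close>.
\<close>

lemma closed_insert_0_K: "closed (insert 0 K)"
proof -
  \<comment> \<open>the coordinates of \<open>x\<close> in the basis \<open>v0, v1\<close>\<close>
  let ?A = "\<lambda>x::real^3. x$3 + (x$2 - x$1) / 3" and ?B = "\<lambda>x::real^3. (x$2 - x$1) / 3 - x$3"
  have eq: "insert 0 K = {x. x$1 + x$2 + x$3 = 0} \<inter> {x. 0 \<le> ?A x} \<inter> {x. 0 \<le> ?B x}" (is "_ = ?R")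
  proof (intro subset_antisym subsetI)
    fix x assume "x \<in> insert 0 K"
    then show "x \<in> ?R" by (auto simp: K_def v0_def v1_def field_simps)
  next
    fix x assume x: "x \<in> ?R"
    then have sum0: "x$1 = - x$2 - x$3" by simp
    have "x = ?A x *\<^sub>R v0 + ?B x *\<^sub>R v1"
      by (simp add: v0_def v1_def vec_eq_iff forall_3 sum0 field_simps)
    then show "x \<in> insert 0 K" unfolding K_def using x
      by (cases "(?A x, ?B x) = (0, 0)") (force, blast)
  qed
  show ?thesis unfolding eq
    by (intro closed_Int closed_Collect_eq closed_Collect_le continuous_intros ballI) simp_all
qed

definition h_word :: "nat list \<Rightarrow> real \<Rightarrow> real" where
  "h_word = foldr (\<lambda>a. if a = 0 then h0 else h1)"

lemma h_word_Nil [simp]: "h_word [] x = x"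
  by (simp add: h_word_def)

lemma h_word_Cons [simp]: "h_word (a # w) x = (if a = 0 then h0 else h1) (h_word w x)"
  by (simp add: h_word_def)

lemma h_word_in_unit: "x \<in> {0..1} \<Longrightarrow> h_word w x \<in> {0..1}"
  by (induction w) (auto simp: h0_def h1_def)

lemma h_word_affine: "h_word w y = h_word w x + (y - x) / 2 ^ length w"
  by (induction w) (auto simp: h0_def h1_def field_simps)

lemma curve_h_word:
  assumes u: "is_curve u" and x: "x \<in> {0..1}"
  shows "u (h_word w x) = M_vec w (u x)"
proof (induction w)
  case (Cons a w)
  have "u (h0 y) = M0 *v u y \<and> u (h1 y) = M1 *v u y" if "y \<in> {0..1}" for y
    using u that by (auto simp: is_curve_def)
  from this[OF h_word_in_unit[OF x, of w]] Cons show ?case by (simp add: M_def)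
qed simp

text \<open>
  The increment over a dyadic interval is the image under a word of the total increment
  \<open>u 1 - u 0 = 2/3 (v0 + v1)\<close>, which lies in \<open>K\<close>.
\<close>

lemma curve_step:
  assumes u: "is_curve u" and "j < 2 ^ n"
  shows "u (real (Suc j) / 2 ^ n) - u (real j / 2 ^ n) \<in> K"
proof -
  have "\<exists>w. length w = n \<and> h_word w 0 = real j / 2 ^ n" if "j < 2 ^ n" for n j
    using that
  proof (induction n arbitrary: j)
    case 0
    then show ?case by simp
  next
    case (Suc n)
    \<comment> \<open>the half of the unit interval that contains \<open>j / 2 ^ Suc n\<close>, that is the leading digit\<close>
    define i where "i = (if j < 2 ^ n then 0 else 1 :: nat)"
    have "j - i * 2 ^ n < 2 ^ n" using Suc.prems by (auto simp: i_def)
    from Suc.IH[OF this] obtain w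
      where w: "length w = n" "h_word w 0 = real (j - i * 2 ^ n) / 2 ^ n" by blast
    have "h_word (i # w) 0 = real j / 2 ^ Suc n"
      using w(2) by (auto simp: i_def h0_def h1_def field_simps of_nat_diff)
    then show ?case using w(1) by (intro exI[of _ "i # w"]) simp
  qed
  then obtain w where w: "length w = n" "h_word w 0 = real j / 2 ^ n" using assms(2) by blast
  then have w1: "h_word w 1 = real (Suc j) / 2 ^ n"
    using h_word_affine[of w 1 0] by (simp add: add_divide_distrib)
  have "u 1 - u 0 = (2/3) *\<^sub>R v0 + (2/3) *\<^sub>R v1"
    using u by (auto simp: is_curve_def v0_def v1_def vec_eq_iff forall_3)
  then have "u 1 - u 0 \<in> K" unfolding K_def by force
  moreover have "u (h_word w 1) - u (h_word w 0) = M_vec w (u 1 - u 0)"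
    using u by (simp add: curve_h_word M_vec_diff)
  ultimately show ?thesis using M_vec_K_subset[of w] w w1 by auto
qed

lemma curve_dyadic:
  assumes u: "is_curve u" and "i \<le> j" "j \<le> 2 ^ n"
  shows "u (real j / 2 ^ n) - u (real i / 2 ^ n) \<in> insert 0 K"
  using assms(2,3)
proof (induction j rule: dec_induct)
  case (step j)
  then have "u (real j / 2 ^ n) - u (real i / 2 ^ n) \<in> insert 0 K" by simp
  moreover have "u (real (Suc j) / 2 ^ n) - u (real j / 2 ^ n) \<in> K"
    using curve_step[OF u] step by simp
  ultimately have "(u (real (Suc j) / 2 ^ n) - u (real j / 2 ^ n))
      + (u (real j / 2 ^ n) - u (real i / 2 ^ n)) \<in> K"
    using K_add by (metis add.right_neutral insertE)
  then show ?case by (simp add: algebra_simps)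
qed simp

text \<open>
  Dyadic points are dense, \<open>u\<close> is continuous and \<open>insert 0 K\<close> is closed.
\<close>

lemma curve_mono:
  assumes u: "is_curve u" and st: "0 \<le> s" "s \<le> t" "t \<le> 1"
  shows "u t - u s \<in> insert 0 K"
proof -
  \<comment> \<open>\<open>d x n\<close> is the largest dyadic of level \<open>n\<close> not above \<open>x\<close>\<close>
  define d where "d x n = real (nat \<lfloor>2 ^ n * x\<rfloor>) / 2 ^ n" for x :: real and n
  have bounds: "x - (1/2) ^ n \<le> d x n" "d x n \<le> x" if "x \<ge> 0" for x n
  proof -
    have "2 ^ n * x - 1 \<le> real (nat \<lfloor>2 ^ n * x\<rfloor>)" "real (nat \<lfloor>2 ^ n * x\<rfloor>) \<le> 2 ^ n * x"
      using that by simp_all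
    then have "(2 ^ n * x - 1) / 2 ^ n \<le> d x n" "d x n \<le> 2 ^ n * x / 2 ^ n"
      unfolding d_def by (intro divide_right_mono; simp)+
    then show "x - (1/2) ^ n \<le> d x n" "d x n \<le> x"
      by (simp_all add: diff_divide_distrib power_one_over)
  qed
  have d_unit: "d x n \<in> {0..1}" if "x \<in> {0..1}" for x n
    using bounds(2)[of x n] that unfolding atLeastAtMost_iff
    by (intro conjI) (simp add: d_def, linarith)
  have d_lim: "d x \<longlonglongrightarrow> x" if "x \<ge> 0" for x
  proof (rule tendsto_sandwich)
    show "(\<lambda>n. x - (1/2) ^ n) \<longlonglongrightarrow> x"
      using LIMSEQ_power_zero[of "1/2 :: real"]
      by (auto intro!: tendsto_eq_intros)
  qed (use bounds that in auto)
  have u_lim: "(\<lambda>n. u (d x n)) \<longlonglongrightarrow> u x" if "x \<in> {0..1}" for x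
  proof (rule continuous_on_tendsto_compose[OF _ _ that])
    show "continuous_on {0..1} u" using u by (simp add: is_curve_def)
    show "d x \<longlonglongrightarrow> x" using that d_lim by simp
    show "\<forall>\<^sub>F n in sequentially. d x n \<in> {0..1}" using d_unit[OF that] by simp
  qed
  have "u (d t n) - u (d s n) \<in> insert 0 K" for n
    unfolding d_def
  proof (rule curve_dyadic[OF u])
    show "nat \<lfloor>2 ^ n * s\<rfloor> \<le> nat \<lfloor>2 ^ n * t\<rfloor>"
      using st by (intro nat_mono floor_mono) simp
    have "2 ^ n * t \<le> real (2 ^ n)" using st by simp
    from floor_mono[OF this] show "nat \<lfloor>2 ^ n * t\<rfloor> \<le> 2 ^ n"
      by (simp only: floor_of_nat nat_le_iff)
  qed
  moreover have "(\<lambda>n. u (d t n) - u (d s n)) \<longlonglongrightarrow> u t - u s"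
    using st by (intro tendsto_diff u_lim) auto
  ultimately show ?thesis
    by (rule closed_sequentially[OF closed_insert_0_K])
qed

text \<open>
  A whole dyadic interval fits between \<open>s\<close> and \<open>t\<close>, and the increment over it lies in \<open>K\<close>. The
  increments on both sides of it, known only up to \<open>insert 0 K\<close>, cannot cancel it because \<open>K\<close> is
  closed under addition and does not contain \<open>0\<close>.
\<close>

lemma curve_strict_mono:
  assumes u: "is_curve u" and st: "0 \<le> s" "s < t" "t \<le> 1"
  shows "u t - u s \<in> K"
proof -
  obtain n where "(1/2 :: real) ^ n < (t - s) / 2"
    using real_arch_pow_inv[of "(t - s) / 2" "1/2"] st by auto
  \<comment> \<open>an interval longer than two steps contains a complete step after rounding \<open>s\<close> upwards\<close>
  then have n: "2 < 2 ^ n * (t - s)" by (simp add: field_simps power_one_over)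
  define j where "j = nat \<lceil>2 ^ n * s\<rceil>"
  have j: "2 ^ n * s \<le> real j" "real j < 2 ^ n * s + 1"
    using st by (auto simp: j_def) linarith+
  have Sj: "real (Suc j) \<le> 2 ^ n * t" using j n by (simp add: algebra_simps)
  also have "\<dots> \<le> 2 ^ n" using st by simp
  finally have "real (Suc j) \<le> real (2 ^ n)" by simp
  then have jn: "j < 2 ^ n" by (subst (asm) of_nat_le_iff) simp
  have lo: "s \<le> real j / 2 ^ n" and hi: "real (Suc j) / 2 ^ n \<le> t"
    and le: "real j / 2 ^ n \<le> real (Suc j) / 2 ^ n"
    using j Sj by (simp_all add: field_simps)
  have 1: "u (real j / 2 ^ n) - u s \<in> insert 0 K"
    by (rule curve_mono[OF u]) (use lo hi le st in linarith)+
  have 2: "u t - u (real (Suc j) / 2 ^ n) \<in> insert 0 K"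
    by (rule curve_mono[OF u]) (use lo hi le st in linarith)+
  have "u (real (Suc j) / 2 ^ n) - u s
      = (u (real (Suc j) / 2 ^ n) - u (real j / 2 ^ n)) + (u (real j / 2 ^ n) - u s)" by simp
  with 1 curve_step[OF u jn] have 3: "u (real (Suc j) / 2 ^ n) - u s \<in> K"
    by (metis K_add add.right_neutral insertE)
  have "u t - u s = (u (real (Suc j) / 2 ^ n) - u s) + (u t - u (real (Suc j) / 2 ^ n))" by simp
  with 2 3 show ?thesis
    by (metis K_add add.right_neutral insertE)
qed

section \<open>Binary expansions\<close>

lemma binary_expansion_digit: "a i = 0 \<or> a i = 1" if "binary_expansion s a" "i \<ge> 1"
  using that by (simp add: binary_expansion_def)

lemma binary_expansion_nonneg: "binary_expansion s a \<Longrightarrow> 0 \<le> s"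
  unfolding binary_expansion_def using sums_le[OF _ sums_zero, of "\<lambda>i. real (a (Suc i)) / 2 ^ Suc i" s]
  by simp

lemma binary_expansion_pos:
  assumes "binary_expansion s a" "i \<ge> 1" "a i = 1"
  shows "0 < s"
proof -
  have "summable (\<lambda>i. real (a (Suc i)) / 2 ^ Suc i)" "s = (\<Sum>i. real (a (Suc i)) / 2 ^ Suc i)"
    using assms(1) by (auto simp: binary_expansion_def sums_iff)
  moreover have "0 < real (a (Suc (i - 1))) / 2 ^ Suc (i - 1)" using assms by simp
  ultimately show ?thesis 
    using suminf_pos2[of "\<lambda>i. real (a (Suc i)) / 2 ^ Suc i" "i - 1"] by simp
qed

text \<open>
  Exchanging the two digits reflects \<open>[0,1]\<close>; so bounds from above follow from bounds from below.
\<close>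

lemma binary_expansion_flip:
  assumes "binary_expansion s a"
  shows "binary_expansion (1 - s) (\<lambda>i. 1 - a i)"
proof -
  have d: "a (Suc i) \<le> 1" for i
    using binary_expansion_digit[OF assms, of "Suc i"] by auto
  have "(\<lambda>i. (1/2) ^ Suc i - real (a (Suc i)) / 2 ^ Suc i) sums (1 - s)"
    using assms by (intro sums_diff power_half_series) (simp add: binary_expansion_def)
  moreover have "(\<lambda>i. (1/2) ^ Suc i - real (a (Suc i)) / 2 ^ Suc i)
      = (\<lambda>i. real (1 - a (Suc i)) / 2 ^ Suc i)"
    using d by (simp add: fun_eq_iff of_nat_diff field_simps power_one_over)
  ultimately show ?thesis by (auto simp: binary_expansion_def)
qed

lemma binary_expansion_shift:
  assumes "binary_expansion s a"
  shows "binary_expansion (2 * s - real (a 1)) (\<lambda>i. a (Suc i))"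
proof -
  let ?f = "\<lambda>i. real (a (Suc i)) / 2 ^ Suc i"
  have "(\<lambda>i. ?f (Suc i)) sums (s - ?f 0)"
    using assms by (subst sums_Suc_iff) (simp add: binary_expansion_def)
  from sums_mult[OF this, of 2] show ?thesis
    using assms by (auto simp: binary_expansion_def algebra_simps)
qed

lemma digits_Suc: "digits a (Suc n) = a 1 # digits (\<lambda>i. a (Suc i)) n"
proof -
  have "[1..<Suc (Suc n)] = 1 # map Suc [1..<Suc n]" 
    by (simp add: upt_conv_Cons map_Suc_upt del: upt_Suc)
  then show ?thesis by (simp add: digits_def o_def del: upt_Suc)
qed

text \<open>
  The point \<open>r\<close> is the relative position of \<open>s\<close> in the dyadic interval addressed by the first \<open>n\<close>
  digits, and the remaining digits are an expansion of it.
\<close>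

lemma binary_expansion_h_word:
  assumes "binary_expansion s a"
  shows "\<exists>r. s = h_word (digits a n) r \<and> binary_expansion r (\<lambda>i. a (n + i))"
  using assms
proof (induction n arbitrary: s a)
  case 0
  then show ?case by (auto simp: digits_def)
next
  case (Suc n)
  from Suc.IH[OF binary_expansion_shift[OF Suc.prems]] obtain r
    where r: "2 * s - real (a 1) = h_word (digits (\<lambda>i. a (Suc i)) n) r"
      "binary_expansion r (\<lambda>i. a (Suc (n + i)))" by auto
  have "a 1 \<in> {0, 1}" using Suc.prems by (auto simp: binary_expansion_def)
  then have "s = h_word (digits a (Suc n)) r"
    using r(1) by (auto simp: digits_Suc h0_def h1_def field_simps)
  then show ?case using r(2) by auto
qed

text \<open>
  The tail of the expansion still contains a digit \<open>0\<close>, which keeps \<open>s\<close> away from the right end point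
  of its dyadic interval.
\<close>

lemma upper_binary_expansion_h_word:
  assumes "upper_binary_expansion s a"
  shows "\<exists>r. 0 \<le> r \<and> r < 1 \<and> s = h_word (digits a n) r"
proof -
  have bin: "binary_expansion s a" using assms by (simp add: upper_binary_expansion_def)
  then obtain r where r: "s = h_word (digits a n) r" "binary_expansion r (\<lambda>i. a (n + i))"
    using binary_expansion_h_word by blast
  obtain k where k: "k \<ge> Suc n" "a k \<noteq> 1"
    using assms by (auto simp: upper_binary_expansion_def)
  then have "a k = 0" using binary_expansion_digit[OF bin, of k] by auto
  then have "0 < 1 - r"
    using k by (intro binary_expansion_pos[OF binary_expansion_flip[OF r(2)], of "k - n"]) auto
  then show ?thesis using binary_expansion_nonneg[OF r(2)] r(1) by auto
qed

lemma lower_binary_expansion_h_word: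
  assumes "lower_binary_expansion s a"
  shows "\<exists>r. 0 < r \<and> r \<le> 1 \<and> s = h_word (digits a n) r"
proof -
  have bin: "binary_expansion s a" using assms by (simp add: lower_binary_expansion_def)
  then obtain r where r: "s = h_word (digits a n) r" "binary_expansion r (\<lambda>i. a (n + i))"
    using binary_expansion_h_word by blast
  obtain k where k: "k \<ge> Suc n" "a k \<noteq> 0"
    using assms by (auto simp: lower_binary_expansion_def)
  then have "a k = 1" using binary_expansion_digit[OF bin, of k] by auto
  then have "0 < r"
    using k by (intro binary_expansion_pos[OF r(2), of "k - n"]) auto
  then show ?thesis using binary_expansion_nonneg[OF binary_expansion_flip[OF r(2)]] r(1) by auto
qed

section \<open>Directions of the chords\<close>

text \<open>
  By self-similarity the chord is the image under the word \<open>w\<close> of the chord from \<open>r\<close> to \<open>r'\<close>.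
\<close>

lemma chord_in_cone:
  assumes u: "is_curve u" and "0 \<le> r" "r < r'" "r' \<le> 1"
  shows "u (h_word w r') - u (h_word w r) \<in> M_vec w ` K"
proof -
  have "u (h_word w r') - u (h_word w r) = M_vec w (u r' - u r)"
    using assms by (simp add: curve_h_word M_vec_diff)
  then show ?thesis using curve_strict_mono assms by blast
qed

lemma right_chords_in_cone:
  assumes u: "is_curve u" and "upper_binary_expansion s a"
  shows "\<forall>\<^sub>F t in at s within {s<..1}. u t - u s \<in> M_vec (digits a n) ` K"
proof -
  obtain r where r: "0 \<le> r" "r < 1" "s = h_word (digits a n) r"
    using upper_binary_expansion_h_word[OF assms(2)] by blast
  have "u t - u s \<in> M_vec (digits a n) ` K" if t: "s < t" "t - s < (1 - r) / 2 ^ n" for t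
  proof -
    \<comment> \<open>\<open>r'\<close> is the position of \<open>t\<close> relative to the dyadic interval of \<open>s\<close>\<close>
    define r' where "r' = r + 2 ^ n * (t - s)"
    have "t = h_word (digits a n) r'"
      using h_word_affine[of "digits a n" r' r] r(3) by (simp add: r'_def)
    moreover have "r < r'" "r' \<le> 1" using t by (simp_all add: r'_def field_simps)
    ultimately show ?thesis using chord_in_cone[OF u r(1)] r(3) by blast
  qed
  then show ?thesis
    unfolding eventually_at using r(2)
    by (intro exI[of _ "(1 - r) / 2 ^ n"]) (auto simp: dist_real_def)
qed

lemma left_chords_in_cone:
  assumes u: "is_curve u" and "lower_binary_expansion s a"
  shows "\<forall>\<^sub>F t in at s within {0..<s}. u s - u t \<in> M_vec (digits a n) ` K"
proof -
  obtain r where r: "0 < r" "r \<le> 1" "s = h_word (digits a n) r"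
    using lower_binary_expansion_h_word[OF assms(2)] by blast
  have "u s - u t \<in> M_vec (digits a n) ` K" if t: "t < s" "s - t < r / 2 ^ n" for t
  proof -
    define r' where "r' = r - 2 ^ n * (s - t)"
    have "t = h_word (digits a n) r'"
      using h_word_affine[of "digits a n" r' r] r(3) by (simp add: r'_def)
    moreover have "0 \<le> r'" "r' < r" using t by (simp_all add: r'_def field_simps)
    ultimately show ?thesis using chord_in_cone[OF u _ _ r(2)] r(3) by blast
  qed
  then show ?thesis
    unfolding eventually_at using r(1)
    by (intro exI[of _ "r / 2 ^ n"]) (auto simp: dist_real_def)
qed

lemma limitin_PH_of_shrinking_cones:
  assumes "l \<in> topspace PH"
    and "\<And>U. openin PH U \<Longrightarrow> l \<in> U \<Longrightarrow> \<exists>n. proj ` C n \<subseteq> U"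
    and d: "\<And>n. \<forall>\<^sub>F t in F. d t \<in> C n"
  shows "limitin PH (\<lambda>t. proj (d t)) l F"
  unfolding limitin_def
proof (intro conjI allI impI)
  fix U assume "openin PH U \<and> l \<in> U"
  then obtain n where "proj ` C n \<subseteq> U" using assms(2) by blast
  then show "\<forall>\<^sub>F t in F. proj (d t) \<in> U" by (intro eventually_mono[OF d[of n]]) blast
qed (rule assms(1))

text \<open>
  The images of a vector of \<open>K\<close> under the words are themselves eventually in each of the nested
  cones, so they converge to the same line as \<open>d\<close> does.
\<close>

lemma limit_of_words_and_directions:
  assumes u0: "u0 \<in> K_proj"
    and d: "\<And>n. \<forall>\<^sub>F t in F. d t \<in> M_vec (digits a n) ` K"
  shows "\<exists>l. limitin PH (\<lambda>t. proj (d t)) l F \<and>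
             limitin PH (\<lambda>n. M_word (digits a n) u0) l sequentially"
proof -
  from nested_cones_shrink[of a] obtain l where l: "l \<in> topspace PH"
    and shrink: "\<And>U. openin PH U \<Longrightarrow> l \<in> U \<Longrightarrow> \<exists>n. proj ` M_vec (digits a n) ` K \<subseteq> U"
    by (elim bexE) (simp only: imp_conjL)
  obtain x where x: "x \<in> K" "u0 = proj x" using u0 by (auto simp: K_proj_def)
  have "\<forall>\<^sub>F m in sequentially. M_vec (digits a m) x \<in> M_vec (digits a n) ` K" for n
    using M_vec_digits_nested[of n _ a] x(1)
    by (intro eventually_sequentiallyI[of n]) blast
  then have "limitin PH (\<lambda>n. proj (M_vec (digits a n) x)) l sequentially"
    by (intro limitin_PH_of_shrinking_cones[OF l shrink])
  moreover have "limitin PH (\<lambda>t. proj (d t)) l F"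
    by (intro limitin_PH_of_shrinking_cones[OF l shrink d])
  ultimately show ?thesis using x(2) by (auto simp: M_word_proj)
qed

theorem proposition5:
  fixes u :: "real \<Rightarrow> real^3"
  assumes "is_curve u"
  shows "(\<forall>s a. s \<in> {0..<1} \<and> upper_binary_expansion s a \<longrightarrow>
            (\<forall>u0\<in>K_proj. \<exists>l.
               limitin PH (\<lambda>t. proj (u t - u s)) l (at s within {s<..1}) \<and>
               limitin PH (\<lambda>n. M_word (digits a n) u0) l sequentially)) \<and>
         (\<forall>s a. s \<in> {0<..1} \<and> lower_binary_expansion s a \<longrightarrow>
            (\<forall>u0\<in>K_proj. \<exists>l.
               limitin PH (\<lambda>t. proj (u s - u t)) l (at s within {0..<s}) \<and>
               limitin PH (\<lambda>n. M_word (digits a n) u0) l sequentially))"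
proof (intro conjI allI ballI impI; elim conjE)
  fix s a u0 assume "upper_binary_expansion s a" "u0 \<in> K_proj"
  then show "\<exists>l. limitin PH (\<lambda>t. proj (u t - u s)) l (at s within {s<..1}) \<and>
      limitin PH (\<lambda>n. M_word (digits a n) u0) l sequentially"
    by (intro limit_of_words_and_directions right_chords_in_cone[OF assms])
next
  fix s a u0 assume "lower_binary_expansion s a" "u0 \<in> K_proj"
  then show "\<exists>l. limitin PH (\<lambda>t. proj (u s - u t)) l (at s within {0..<s}) \<and>
      limitin PH (\<lambda>n. M_word (digits a n) u0) l sequentially"
    by (intro limit_of_words_and_directions left_chords_in_cone[OF assms])
qed

end
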